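(* Let $k\geq 2$ and $n\geq 2$ be integers. Then: (i) for an integer $r$ with $0\leq r\leq n$, the digraph $H_k^{r,r}(n-1)$ is Eulerian if and only if $r\in\{0,1,n-1,n\}$; (ii) $H_k^{r,r+1}(n-1)$ is Eulerian for every integer $r$ with $0\leq r<n$.
   Context: A $k$-ary $n$-tuple is an element of $\mathbb{Z}_k^n$, with entries identified with the integers $0,1,\dots,k-1$. The de Bruijn digraph $B_k(n-1)$ has vertex set $\mathbb{Z}_k^{n-1}$, and its edges are identified with the $k$-ary $n$-tuples: the $n$-tuple $(x_0,\dots,x_{n-1})$ is the edge from vertex $(x_0,\dots,x_{n-2})$ to vertex $(x_1,\dots,x_{n-1})$ (loops allowed). A subgraph "consisting of" a set of edges has exactly those edges, and its vertices are the vertices incident with at least one of them. A digraph is Eulerian if it is strongly connected (there is a directed path between any ordered pair of its vertices) and balanced (every vertex has in-degree equal to out-degree). The Hamming weight $w_h(\mathbf{a})$ of a $k$-ary $n$-tuple $\mathbf{a}=(a_0,\dots,a_{n-1})$ is the number of indices $i$ with $a_i\neq 0$. For integers $0\leq r\leq s\leq n$, $H_k^{r,s}(n-1)$ is the subgraph of $B_k(n-1)$ consisting of the edges corresponding to $n$-tuples $\mathbf{a}$ with $r\leq w_h(\mathbf{a})\leq s$. *)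

theory Defs
  imports "Graph_Theory.Digraph_Component"
begin

text \<open>An element of \<open>\<int>\<^sub>k\<^sup>n\<close> is a list of length \<open>n\<close> with entries among \<open>0, \<dots>, k - 1\<close>.\<close>

definition tuples :: "nat \<Rightarrow> nat \<Rightarrow> nat list set" where
  "tuples k n = {a. length a = n \<and> set a \<subseteq> {0..<k}}"

definition hamming_weight :: "nat list \<Rightarrow> nat" where
  "hamming_weight a = card {i. i < length a \<and> a ! i \<noteq> 0}"

text \<open>\<open>de_bruijn k m\<close> is \<open>B\<^sub>k(m)\<close>: the argument is the length of the vertices, and the
  arcs are the tuples of length \<open>m + 1\<close>.\<close>

definition de_bruijn :: "nat \<Rightarrow> nat \<Rightarrow> (nat list, nat list) pre_digraph" where
  "de_bruijn k m =
    \<lparr> verts = tuples k m, arcs = tuples k (m + 1), tail = butlast, head = tl \<rparr>"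

text \<open>The subgraph consisting of the arcs in \<open>E\<close> has as its vertices only the endpoints
  of these arcs.\<close>

definition arc_subgraph :: "('a, 'b) pre_digraph \<Rightarrow> 'b set \<Rightarrow> ('a, 'b) pre_digraph" where
  "arc_subgraph G E =
    \<lparr> verts = tail G ` E \<union> head G ` E, arcs = E, tail = tail G, head = head G \<rparr>"

text \<open>\<open>weight_digraph k r s m\<close> is \<open>H\<^sub>k\<^sup>r\<^sup>,\<^sup>s(m)\<close>.\<close>

definition weight_digraph ::
  "nat \<Rightarrow> nat \<Rightarrow> nat \<Rightarrow> nat \<Rightarrow> (nat list, nat list) pre_digraph" where
  "weight_digraph k r s m =
    arc_subgraph (de_bruijn k m)
      {a \<in> arcs (de_bruijn k m). r \<le> hamming_weight a \<and> hamming_weight a \<le> s}"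

definition balanced :: "('a, 'b) pre_digraph \<Rightarrow> bool" where
  "balanced G \<longleftrightarrow> (\<forall>v \<in> verts G. in_degree G v = out_degree G v)"

definition eulerian :: "('a, 'b) pre_digraph \<Rightarrow> bool" where
  "eulerian G \<longleftrightarrow> strongly_connected G \<and> balanced G"

lemma finite_tuples: "finite (tuples k n)"
  using finite_lists_length_eq[of "{0..<k}" n] by (simp add: tuples_def conj_commute)

lemma fin_digraph_de_bruijn: "fin_digraph (de_bruijn k m)"
proof
  show "tail (de_bruijn k m) e \<in> verts (de_bruijn k m)" if "e \<in> arcs (de_bruijn k m)" for e
    using that by (auto simp: de_bruijn_def tuples_def dest: in_set_butlastD)
  show "head (de_bruijn k m) e \<in> verts (de_bruijn k m)" if "e \<in> arcs (de_bruijn k m)" for e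
    using that by (cases e) (auto simp: de_bruijn_def tuples_def)
qed (simp_all add: de_bruijn_def finite_tuples)

lemma subgraph_arc_subgraph:
  assumes "wf_digraph G" and "E \<subseteq> arcs G"
  shows "subgraph (arc_subgraph G E) G"
  using assms
  by (auto simp: subgraph_def compatible_def arc_subgraph_def wf_digraph_def)

lemma subgraph_weight_digraph: "subgraph (weight_digraph k r s m) (de_bruijn k m)"
  unfolding weight_digraph_def
  by (rule subgraph_arc_subgraph) (use fin_digraph_de_bruijn in \<open>auto simp: fin_digraph_def\<close>)

end

theory Submission
  imports Defs
begin

text \<open>An arc \<open>a\<close> is followed by its cyclic rotation, which has the same weight. Hence every arc
  lies on a closed walk, all in- and out-degrees agree, and two arcs that differ in a single entry
  are mutually reachable (rotate that entry to the end, where both arcs have the same tail).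
  Two tuples with weights in \<open>{r, r + 1}\<close> are joined by single-entry changes, and so are two
  tuples with the same support; for \<open>r \<in> {0, 1, n - 1, n}\<close> all supports of size \<open>r\<close> are rotations of
  one another. Conversely, in \<open>H\<^sub>k\<^sup>r\<^sup>,\<^sup>r(n - 1)\<close> the support is only rotated along a walk, and for
  \<open>2 \<le> r \<le> n - 2\<close> the supports of \<open>1\<^sup>r0\<^sup>n\<^sup>-\<^sup>r\<close> and \<open>1\<^sup>r\<^sup>-\<^sup>1010\<^sup>n\<^sup>-\<^sup>r\<^sup>-\<^sup>1\<close> are not rotations of each other.\<close>

section \<open>Hamming weight, supports and rotation of lists\<close>

lemma hamming_weight_eq_length_filter: "hamming_weight a = length (filter (\<lambda>x. x \<noteq> 0) a)"
  by (simp add: hamming_weight_def length_filter_conv_card)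

lemma hamming_weight_append [simp]: "hamming_weight (a @ b) = hamming_weight a + hamming_weight b"
  by (simp add: hamming_weight_eq_length_filter)

lemma hamming_weight_Cons [simp]:
  "hamming_weight (x # a) = (if x = 0 then 0 else 1) + hamming_weight a"
  by (simp add: hamming_weight_eq_length_filter)

lemma hamming_weight_Nil [simp]: "hamming_weight [] = 0"
  by (simp add: hamming_weight_eq_length_filter)

lemma hamming_weight_replicate [simp]:
  "hamming_weight (replicate j x) = (if x = 0 then 0 else j)"
  by (simp add: hamming_weight_eq_length_filter)

lemma hamming_weight_rotate1 [simp]: "hamming_weight (rotate1 a) = hamming_weight a"
  by (cases a) simp_all

lemma hamming_weight_rotate [simp]: "hamming_weight (rotate j a) = hamming_weight a"
  by (induction j) simp_all

text \<open>Stated additively, so that gaining, losing and keeping a nonzero entry are covered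
  together without truncated subtraction.\<close>

lemma hamming_weight_update:
  assumes "i < length a"
  shows "hamming_weight (a[i := x]) + (if a ! i = 0 then 0 else 1)
           = hamming_weight a + (if x = 0 then 0 else 1)"
proof -
  have "hamming_weight a = hamming_weight (take i a @ a ! i # drop (Suc i) a)"
    using assms by (simp flip: id_take_nth_drop)
  then show ?thesis
    using assms by (simp add: upd_conv_take_nth_drop)
qed

lemma hamming_weight_strict_mono:
  assumes "length a = length b" and "\<And>i. i < length a \<Longrightarrow> a ! i \<noteq> 0 \<Longrightarrow> b ! i \<noteq> 0"
    and "j < length a" and "a ! j = 0" and "b ! j \<noteq> 0"
  shows "hamming_weight a < hamming_weight b"
proof -
  have "{i. i < length a \<and> a ! i \<noteq> 0} \<subseteq> {i. i < length b \<and> b ! i \<noteq> 0} - {j}"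
    using assms(1,2,4) by auto
  moreover have "j \<in> {i. i < length b \<and> b ! i \<noteq> 0}"
    using assms(1,3,5) by simp
  ultimately have "{i. i < length a \<and> a ! i \<noteq> 0} \<subset> {i. i < length b \<and> b ! i \<noteq> 0}"
    by blast
  then show ?thesis
    unfolding hamming_weight_def by (intro psubset_card_mono) simp_all
qed

lemma card_zeros_plus_hamming_weight:
  "card {i. i < length a \<and> a ! i = 0} + hamming_weight a = length a"
  unfolding hamming_weight_eq_length_filter
  using sum_length_filter_compl[of "\<lambda>x. x = 0" a] length_filter_conv_card[of "\<lambda>x. x = 0" a]
  by metis

text \<open>The lists differ at most in the last entry, and equal weights force the two last entries
  to be both zero or both nonzero. This is where having a single weight restricts the walks.\<close>

lemma same_weight_same_butlast_support:
  assumes "length a = length b" and "butlast a = butlast b"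
    and "hamming_weight a = hamming_weight b" and "i < length a"
  shows "a ! i = 0 \<longleftrightarrow> b ! i = 0"
proof -
  have "a \<noteq> []" "b \<noteq> []" using assms by auto
  then obtain u x y where "a = u @ [x]" "b = u @ [y]"
    using assms(2) by (metis append_butlast_last_id)
  then show ?thesis
    using assms by (auto simp: nth_append split: if_splits)
qed

text \<open>The invariant that separates supports up to rotation: an isolated zero in the cyclic
  word. The index \<open>i\<close> is unbounded and reduced modulo the length, so a rotation merely
  shifts it.\<close>

definition cyclic_gap :: "nat list \<Rightarrow> bool" where
  "cyclic_gap a \<longleftrightarrow> (\<exists>i. a ! (i mod length a) \<noteq> 0 \<and> a ! (Suc i mod length a) = 0
                        \<and> a ! (Suc (Suc i) mod length a) \<noteq> 0)"

lemma cyclic_gap_cong: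
  assumes "length a = length b" and "\<And>i. i < length a \<Longrightarrow> a ! i = 0 \<longleftrightarrow> b ! i = 0" and "a \<noteq> []"
  shows "cyclic_gap a \<longleftrightarrow> cyclic_gap b"
proof -
  have "a ! (i mod length a) = 0 \<longleftrightarrow> b ! (i mod length b) = 0" for i
    using assms by (metis length_greater_0_conv mod_less_divisor)
  then show ?thesis by (simp add: cyclic_gap_def)
qed

text \<open>A gap of \<open>rotate1 a\<close> at \<open>i\<close> is a gap of \<open>a\<close> at
  \<open>Suc i\<close>.\<close>

lemma cyclic_gap_rotate1:
  assumes "cyclic_gap (rotate1 a)" and "a \<noteq> []"
  shows "cyclic_gap a"
proof -
  have "rotate1 a ! (i mod length a) = a ! (Suc i mod length a)" for i
    using assms(2) by (simp add: nth_rotate1 mod_Suc_eq)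
  with assms(1) show ?thesis
    unfolding cyclic_gap_def by (metis length_rotate1)
qed

section \<open>Arcs, vertices and balance of the weight digraphs\<close>

lemma weight_digraph_simps [simp]:
  "tail (weight_digraph k r s m) = butlast"
  "head (weight_digraph k r s m) = tl"
  by (simp_all add: weight_digraph_def arc_subgraph_def de_bruijn_def)

lemma arcs_weight_digraph:
  "a \<in> arcs (weight_digraph k r s m) \<longleftrightarrow>
     length a = Suc m \<and> set a \<subseteq> {..<k} \<and> r \<le> hamming_weight a \<and> hamming_weight a \<le> s"
  by (auto simp: weight_digraph_def arc_subgraph_def de_bruijn_def tuples_def)

lemma verts_weight_digraph:
  "verts (weight_digraph k r s m) =
     butlast ` arcs (weight_digraph k r s m) \<union> tl ` arcs (weight_digraph k r s m)"
  by (simp add: weight_digraph_def arc_subgraph_def de_bruijn_def)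

lemma wf_weight_digraph: "wf_digraph (weight_digraph k r s m)"
  by unfold_locales (auto simp: verts_weight_digraph)

lemma rotate1_in_arcs_iff [simp]:
  "rotate1 a \<in> arcs (weight_digraph k r s m) \<longleftrightarrow> a \<in> arcs (weight_digraph k r s m)"
  by (simp add: arcs_weight_digraph)

lemma rotate_in_arcs_iff [simp]:
  "rotate j a \<in> arcs (weight_digraph k r s m) \<longleftrightarrow> a \<in> arcs (weight_digraph k r s m)"
  by (induction j) simp_all

text \<open>The head of the arc \<open>a\<close> is the tail of the arc \<open>rotate1 a\<close>, so
  the second can follow the first in a walk.\<close>

lemma butlast_rotate1: "butlast (rotate1 a) = tl a"
  by (cases a) simp_all

text \<open>Rotation by one place is injective, keeps the weight, and maps the arcs into
  \<open>v\<close> onto the arcs out of \<open>v\<close>.\<close>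

lemma balanced_weight_digraph: "balanced (weight_digraph k r s m)"
proof -
  let ?G = "weight_digraph k r s m"
  have "in_degree ?G v = out_degree ?G v" for v
  proof -
    have "rotate1 ` in_arcs ?G v = out_arcs ?G v"
    proof (intro equalityI subsetI)
      fix b assume "b \<in> out_arcs ?G v"
      moreover obtain a where "b = rotate1 a" using surj_rotate1 by blast
      ultimately show "b \<in> rotate1 ` in_arcs ?G v"
        by (auto simp: in_arcs_def out_arcs_def butlast_rotate1)
    qed (auto simp: in_arcs_def out_arcs_def butlast_rotate1)
    then show ?thesis
      unfolding in_degree_def out_degree_def
      by (metis card_image inj_on_subset inj_rotate1 subset_UNIV)
  qed
  then show ?thesis by (simp add: balanced_def)
qed

section \<open>Walks by rotation and by changes of single entries\<close>

lemma reachable_rotate: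
  assumes "a \<in> arcs (weight_digraph k r s m)"
  shows "butlast a \<rightarrow>\<^sup>*\<^bsub>weight_digraph k r s m\<^esub> butlast (rotate j a)"
proof (induction j)
  interpret wf_digraph "weight_digraph k r s m" by (rule wf_weight_digraph)
  case 0
  show ?case using assms by (auto simp: verts_weight_digraph)
next
  interpret wf_digraph "weight_digraph k r s m" by (rule wf_weight_digraph)
  case (Suc j)
  have "butlast (rotate j a) \<rightarrow>\<^bsub>weight_digraph k r s m\<^esub> butlast (rotate (Suc j) a)"
    using assms in_arcs_imp_in_arcs_ends[of "rotate j a"] by (simp add: butlast_rotate1)
  with Suc show ?case by (rule reachable_adj_trans)
qed

lemma reachable_from_rotate:
  assumes "a \<in> arcs (weight_digraph k r s m)"
  shows "butlast (rotate j a) \<rightarrow>\<^sup>*\<^bsub>weight_digraph k r s m\<^esub> butlast a"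
proof -
  \<comment> \<open>Rotating on to a multiple of the length returns to \<open>a\<close>. The
    multiple \<open>length a * j\<close> is at least \<open>j\<close> because arcs are nonempty, so
    the subtraction below does not truncate.\<close>
  have "j \<le> length a * j" using assms by (simp add: arcs_weight_digraph)
  then have "(length a * j - j + j) mod length a = 0" by simp
  then have "rotate (length a * j - j) (rotate j a) = a"
    by (metis rotate_rotate rotate_id)
  then show ?thesis
    using reachable_rotate[of "rotate j a" k r s m "length a * j - j"] assms by simp
qed

lemma reachable_update:
  assumes "a \<in> arcs (weight_digraph k r s m)" and "a[i := x] \<in> arcs (weight_digraph k r s m)"
  shows "butlast a \<rightarrow>\<^sup>*\<^bsub>weight_digraph k r s m\<^esub> butlast (a[i := x])"
proof (cases "i < length a")
  case True
  interpret wf_digraph "weight_digraph k r s m" by (rule wf_weight_digraph)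
  \<comment> \<open>Rotation by \<open>Suc i\<close> moves entry \<open>i\<close> to the last place,
    where \<open>butlast\<close> deletes it. The two rotated arcs thus share a tail.\<close>
  have rot: "rotate (Suc i) (take i a @ y # drop (Suc i) a) = drop (Suc i) a @ take i a @ [y]" for y
    using True rotate_append[of "take i a @ [y]" "drop (Suc i) a"] by simp
  have "butlast (rotate (Suc i) a) = butlast (rotate (Suc i) (a[i := x]))"
    using rot[of "a ! i"] rot[of x] True
    by (simp add: butlast_append flip: id_take_nth_drop upd_conv_take_nth_drop del: rotate_Suc)
  then show ?thesis
    by (metis assms reachable_rotate reachable_from_rotate reachable_trans)
next
  case False
  then have "a[i := x] = a" by (simp add: list_update_beyond)
  then show ?thesis using reachable_rotate[OF assms(1), of 0] by simp
qed

text \<open>Induction on the number of positions where \<open>a\<close> and \<open>b\<close> differ.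
  The set \<open>A\<close> confines the intermediate arcs: it is later taken to be all arcs, or the
  arcs with the support of \<open>b\<close>.\<close>

lemma reachable_by_updates:
  assumes "A \<subseteq> arcs (weight_digraph k r s m)" and "a \<in> A" and "b \<in> A"
    and step: "\<And>a. a \<in> A \<Longrightarrow> a \<noteq> b \<Longrightarrow> \<exists>i < length a. a ! i \<noteq> b ! i \<and> a[i := b ! i] \<in> A"
  shows "butlast a \<rightarrow>\<^sup>*\<^bsub>weight_digraph k r s m\<^esub> butlast b"
  using \<open>a \<in> A\<close>
proof (induction "card {i. i < length a \<and> a ! i \<noteq> b ! i}" arbitrary: a rule: less_induct)
  case less
  interpret wf_digraph "weight_digraph k r s m" by (rule wf_weight_digraph)
  show ?case
  proof (cases "a = b")
    case True
    then show ?thesis using assms by (auto simp: verts_weight_digraph)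
  next
    case False
    then obtain i where i: "i < length a" "a ! i \<noteq> b ! i" "a[i := b ! i] \<in> A"
      using step less.prems by blast
    let ?c = "a[i := b ! i]"
    \<comment> \<open>Position \<open>i\<close> now agrees with \<open>b\<close>, and no other
      position has changed.\<close>
    have "card {j. j < length ?c \<and> ?c ! j \<noteq> b ! j} < card {j. j < length a \<and> a ! j \<noteq> b ! j}"
    proof (rule psubset_card_mono)
      have "{j. j < length ?c \<and> ?c ! j \<noteq> b ! j} \<subseteq> {j. j < length a \<and> a ! j \<noteq> b ! j} - {i}"
        using i(1) by (auto simp: nth_list_update split: if_splits)
      then show "{j. j < length ?c \<and> ?c ! j \<noteq> b ! j} \<subset> {j. j < length a \<and> a ! j \<noteq> b ! j}"
        using i by blast
    qed simp
    then have "butlast ?c \<rightarrow>\<^sup>*\<^bsub>weight_digraph k r s m\<^esub> butlast b"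
      using less.hyps i(3) by blast
    moreover have "butlast a \<rightarrow>\<^sup>*\<^bsub>weight_digraph k r s m\<^esub> butlast ?c"
      using reachable_update assms(1) less.prems i(3) by blast
    ultimately show ?thesis by (metis reachable_trans)
  qed
qed

section \<open>Eulerian cases\<close>

lemma eulerian_weight_digraphI:
  assumes "k \<ge> 2" and "r \<le> s" and "r \<le> Suc m"
    and reach: "\<And>a b. a \<in> arcs (weight_digraph k r s m) \<Longrightarrow> b \<in> arcs (weight_digraph k r s m) \<Longrightarrow>
             butlast a \<rightarrow>\<^sup>*\<^bsub>weight_digraph k r s m\<^esub> butlast b"
  shows "eulerian (weight_digraph k r s m)"
proof -
  let ?G = "weight_digraph k r s m"
  \<comment> \<open>Strong connectedness includes having a vertex. This arc provides one; its entry
    1 is allowed since \<open>k \<ge> 2\<close>.\<close>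
  have "replicate r 1 @ replicate (Suc m - r) 0 \<in> arcs ?G"
    using assms by (auto simp: arcs_weight_digraph)
  then have "verts ?G \<noteq> {}" by (auto simp: verts_weight_digraph)
  \<comment> \<open>The head of an arc is the tail of its rotation, so it is enough to connect
    tails.\<close>
  moreover have "\<exists>a \<in> arcs ?G. v = butlast a" if "v \<in> verts ?G" for v
    using that by (auto simp: verts_weight_digraph) (metis butlast_rotate1 rotate1_in_arcs_iff)
  ultimately show ?thesis
    using reach balanced_weight_digraph
    unfolding eulerian_def strongly_connected_def by metis
qed

lemma update_in_arcs:
  assumes "a \<in> arcs (weight_digraph k r s m)" and "b \<in> arcs (weight_digraph k r' s' m)"
    and "i < length a" and "r \<le> hamming_weight (a[i := b ! i])"
    and "hamming_weight (a[i := b ! i]) \<le> s"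
  shows "a[i := b ! i] \<in> arcs (weight_digraph k r s m)"
proof -
  have "i < length b" using assms(1-3) by (simp add: arcs_weight_digraph)
  moreover have "set b \<subseteq> {..<k}" using assms(2) by (simp add: arcs_weight_digraph)
  ultimately have "b ! i \<in> {..<k}" by (meson nth_mem subsetD)
  then have "set (a[i := b ! i]) \<subseteq> {..<k}"
    using assms(1) by (intro set_update_subsetI) (auto simp: arcs_weight_digraph)
  then show ?thesis using assms by (simp add: arcs_weight_digraph)
qed

lemma eulerian_two_weights:
  assumes "k \<ge> 2" and "r \<le> m"
  shows "eulerian (weight_digraph k r (r + 1) m)"
proof (rule eulerian_weight_digraphI)
  let ?G = "weight_digraph k r (r + 1) m"
  fix a b assume "a \<in> arcs ?G" and b: "b \<in> arcs ?G"
  show "butlast a \<rightarrow>\<^sup>*\<^bsub>?G\<^esub> butlast b"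
  proof (rule reachable_by_updates[OF order_refl \<open>a \<in> arcs ?G\<close> b])
    fix a assume a: "a \<in> arcs ?G" and "a \<noteq> b"
    have len: "length a = length b" using a b by (simp add: arcs_weight_digraph)
    then obtain j where j: "j < length a" "a ! j \<noteq> b ! j"
      using \<open>a \<noteq> b\<close> nth_equalityI by blast
    have "\<exists>i < length a. a ! i \<noteq> b ! i \<and> r \<le> hamming_weight (a[i := b ! i])
            \<and> hamming_weight (a[i := b ! i]) \<le> r + 1"
    \<comment> \<open>Exchanging one nonzero value for another keeps the weight. If no such exchange
      is available, every difference between \<open>a\<close> and \<open>b\<close> is a difference
      of supports, and the weight of \<open>a\<close> decides whether to enlarge or shrink its
      support.\<close>
    proof (cases "\<exists>i < length a. a ! i \<noteq> b ! i \<and> a ! i \<noteq> 0 \<and> b ! i \<noteq> 0")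
      case True
      then obtain i where "i < length a" "a ! i \<noteq> b ! i" "a ! i \<noteq> 0" "b ! i \<noteq> 0" by blast
      then show ?thesis
        using hamming_weight_update[of i a "b ! i"] a by (auto simp: arcs_weight_digraph)
    next
      case no_swap: False
      show ?thesis
      proof (cases "hamming_weight a = r")
        case True
        have "\<exists>i < length a. a ! i = 0 \<and> b ! i \<noteq> 0"
        proof (rule ccontr)
          assume none: "\<not> ?thesis"
          \<comment> \<open>Otherwise the support of \<open>b\<close> lies inside that of
            \<open>a\<close>, properly because of \<open>j\<close>, and \<open>b\<close> would have
            weight below \<open>r\<close>.\<close>
          have "hamming_weight b < hamming_weight a"
          proof (rule hamming_weight_strict_mono)
            show "b ! j = 0" "a ! j \<noteq> 0" using none no_swap j by metis+
          qed (use none len j in auto)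
          then show False using True b by (simp add: arcs_weight_digraph)
        qed
        then obtain i where "i < length a" "a ! i = 0" "b ! i \<noteq> 0" by blast
        then show ?thesis
          using hamming_weight_update[of i a "b ! i"] True by auto
      next
        case False
        then have wt: "hamming_weight a = r + 1" using a by (simp add: arcs_weight_digraph)
        have "\<exists>i < length a. a ! i \<noteq> 0 \<and> b ! i = 0"
        proof (rule ccontr)
          assume none: "\<not> ?thesis"
          \<comment> \<open>Symmetrically, \<open>b\<close> would have weight above
            \<open>r + 1\<close>.\<close>
          have "hamming_weight a < hamming_weight b"
          proof (rule hamming_weight_strict_mono)
            show "a ! j = 0" "b ! j \<noteq> 0" using none no_swap j by metis+
          qed (use none len j in auto)
          then show False using wt b by (simp add: arcs_weight_digraph)
        qed
        then obtain i where "i < length a" "a ! i \<noteq> 0" "b ! i = 0" by blast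
        then show ?thesis
          using hamming_weight_update[of i a "b ! i"] wt by auto
      qed
    qed
    then show "\<exists>i < length a. a ! i \<noteq> b ! i \<and> a[i := b ! i] \<in> arcs ?G"
      using update_in_arcs[OF a b] by blast
  qed
qed (use assms in auto)

text \<open>Copying entries of \<open>b\<close> into \<open>a\<close> one at a time never changes
  the support, hence never the weight.\<close>

lemma reachable_same_support:
  assumes a: "a \<in> arcs (weight_digraph k r s m)" and b: "b \<in> arcs (weight_digraph k r s m)"
    and supp: "\<And>i. i < length a \<Longrightarrow> a ! i = 0 \<longleftrightarrow> b ! i = 0"
  shows "butlast a \<rightarrow>\<^sup>*\<^bsub>weight_digraph k r s m\<^esub> butlast b"
proof -
  let ?A = "{c \<in> arcs (weight_digraph k r s m). \<forall>i < length c. c ! i = 0 \<longleftrightarrow> b ! i = 0}"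
  show ?thesis
  proof (rule reachable_by_updates[of ?A])
    fix c assume c: "c \<in> ?A" and "c \<noteq> b"
    moreover have "length c = length b" using c b by (simp add: arcs_weight_digraph)
    ultimately obtain i where i: "i < length c" "c ! i \<noteq> b ! i" using nth_equalityI by blast
    then have "hamming_weight (c[i := b ! i]) = hamming_weight c"
      using hamming_weight_update[of i c "b ! i"] c by auto
    then have "c[i := b ! i] \<in> arcs (weight_digraph k r s m)"
      using c by (intro update_in_arcs[OF _ b i(1)]) (simp_all add: arcs_weight_digraph)
    then have "c[i := b ! i] \<in> ?A"
      using c i by (auto simp: nth_list_update)
    with i show "\<exists>i < length c. c ! i \<noteq> b ! i \<and> c[i := b ! i] \<in> ?A" by blast
  qed (use assms in auto)
qed

text \<open>\<open>P\<close> marks the zeros of a canonical support. The walk rotates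
  \<open>a\<close> to that support, changes the nonzero values to those of the rotated
  \<open>b\<close>, and undoes the rotation of \<open>b\<close>.\<close>

lemma eulerian_if_supports_rotate:
  assumes "k \<ge> 2" and "r \<le> Suc m"
    and canon: "\<And>a. length a = Suc m \<Longrightarrow> hamming_weight a = r \<Longrightarrow>
             \<exists>j. \<forall>i < Suc m. rotate j a ! i = 0 \<longleftrightarrow> P i"
  shows "eulerian (weight_digraph k r r m)"
proof (rule eulerian_weight_digraphI)
  let ?G = "weight_digraph k r r m"
  interpret wf_digraph ?G by (rule wf_weight_digraph)
  fix a b assume a: "a \<in> arcs ?G" and b: "b \<in> arcs ?G"
  obtain j where j: "\<forall>i < Suc m. rotate j a ! i = 0 \<longleftrightarrow> P i"
    using canon[of a] a by (auto simp: arcs_weight_digraph)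
  obtain l where l: "\<forall>i < Suc m. rotate l b ! i = 0 \<longleftrightarrow> P i"
    using canon[of b] b by (auto simp: arcs_weight_digraph)
  have "butlast (rotate j a) \<rightarrow>\<^sup>*\<^bsub>?G\<^esub> butlast (rotate l b)"
  proof (rule reachable_same_support)
    fix i assume "i < length (rotate j a)"
    with a have "i < Suc m" by (simp add: arcs_weight_digraph)
    with j l show "rotate j a ! i = 0 \<longleftrightarrow> rotate l b ! i = 0" by simp
  qed (use a b in simp_all)
  then show "butlast a \<rightarrow>\<^sup>*\<^bsub>?G\<^esub> butlast b"
    using reachable_rotate[OF a] reachable_from_rotate[OF b] by (metis reachable_trans)
qed (use assms in auto)

lemma Collect_card_1D:
  assumes "card {x. Q x} = 1" and "Q a"
  shows "Q x \<longleftrightarrow> x = a"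
proof -
  obtain y where "{x. Q x} = {y}" using assms(1) by (rule card_1_singletonE)
  then have "Q x \<longleftrightarrow> x = y" for x by (metis mem_Collect_eq singleton_iff)
  with assms(2) show ?thesis by simp
qed

lemma eulerian_single_weight:
  assumes "k \<ge> 2" and "r \<in> {0, 1, m, Suc m}"
  shows "eulerian (weight_digraph k r r m)"
proof -
  consider "r = 0" | "r = Suc m" | "r = 1" | "r = m" using assms by auto
  then show ?thesis
  proof cases
    case 1
    show ?thesis
    proof (rule eulerian_if_supports_rotate[OF assms(1)])
      fix a assume "length a = Suc m" "hamming_weight a = r"
      then have "\<forall>i < Suc m. rotate 0 a ! i = 0 \<longleftrightarrow> True"
        using 1 by (auto simp: hamming_weight_def)
      then show "\<exists>j. \<forall>i < Suc m. rotate j a ! i = 0 \<longleftrightarrow> True" ..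
    qed (use 1 in simp)
  next
    case 2
    show ?thesis
    proof (rule eulerian_if_supports_rotate[OF assms(1)])
      fix a assume "length a = Suc m" "hamming_weight a = r"
      then have "\<forall>i < Suc m. rotate 0 a ! i = 0 \<longleftrightarrow> False"
        using 2 card_zeros_plus_hamming_weight[of a] by auto
      then show "\<exists>j. \<forall>i < Suc m. rotate j a ! i = 0 \<longleftrightarrow> False" ..
    qed (use 2 in simp)
  next
    case 3
    show ?thesis
    proof (rule eulerian_if_supports_rotate[OF assms(1)])
      fix a assume a: "length a = Suc m" "hamming_weight a = r"
      then have "{i. i < length a \<and> a ! i \<noteq> 0} \<noteq> {}"
        using 3 unfolding hamming_weight_def by (metis card.empty zero_neq_one)
      \<comment> \<open>Rotation by \<open>j\<close> brings the only nonzero entry to position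
        0.\<close>
      then obtain j where j: "j < length a" "a ! j \<noteq> 0" by blast
      have hd: "rotate j a ! 0 \<noteq> 0" using a j by (simp add: nth_rotate)
      have "card {i. i < Suc m \<and> rotate j a ! i \<noteq> 0} = 1"
        using hamming_weight_rotate[of j a] a 3 by (simp only: hamming_weight_def length_rotate)
      from Collect_card_1D[OF this, of 0] hd
      have "i < Suc m \<and> rotate j a ! i \<noteq> 0 \<longleftrightarrow> i = 0" for i by blast
      then have "\<forall>i < Suc m. rotate j a ! i = 0 \<longleftrightarrow> i \<noteq> 0" by metis
      then show "\<exists>j. \<forall>i < Suc m. rotate j a ! i = 0 \<longleftrightarrow> i \<noteq> 0" ..
    qed (use 3 in simp)
  next
    case 4
    show ?thesis
    proof (rule eulerian_if_supports_rotate[OF assms(1)])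
      fix a assume a: "length a = Suc m" "hamming_weight a = r"
      then have "card {i. i < length a \<and> a ! i = 0} = 1"
        using 4 card_zeros_plus_hamming_weight[of a] by simp
      \<comment> \<open>Here the weight is one less than the length, and rotation by
        \<open>j\<close> brings the only zero to position 0.\<close>
      then obtain j where j: "j < length a" "a ! j = 0"
        by (auto simp: card_1_singleton_iff)
      have hd: "rotate j a ! 0 = 0" using a j by (simp add: nth_rotate)
      have "card {i. i < Suc m \<and> rotate j a ! i = 0} = 1"
        using card_zeros_plus_hamming_weight[of "rotate j a"] a 4 by simp
      from Collect_card_1D[OF this, of 0] hd
      have "i < Suc m \<and> rotate j a ! i = 0 \<longleftrightarrow> i = 0" for i by blast
      then have "\<forall>i < Suc m. rotate j a ! i = 0 \<longleftrightarrow> i = 0" by metis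
      then show "\<exists>j. \<forall>i < Suc m. rotate j a ! i = 0 \<longleftrightarrow> i = 0" ..
    qed (use 4 in simp)
  qed
qed

section \<open>The obstruction for a single weight\<close>

lemma reachable_preserves_no_cyclic_gap:
  assumes "butlast a \<rightarrow>\<^sup>*\<^bsub>weight_digraph k r r m\<^esub> v"
    and "a \<in> arcs (weight_digraph k r r m)" and "\<not> cyclic_gap a"
    and "b \<in> arcs (weight_digraph k r r m)" and "butlast b = v"
  shows "\<not> cyclic_gap b"
proof -
  let ?G = "weight_digraph k r r m"
  interpret wf_digraph ?G by (rule wf_weight_digraph)
  \<comment> \<open>Having a gap depends only on the tail of an arc, so it can be followed along a
    walk of vertices.\<close>
  have gap_cong: "cyclic_gap c \<longleftrightarrow> cyclic_gap d"
    if "c \<in> arcs ?G" "d \<in> arcs ?G" "butlast c = butlast d" for c d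
  proof -
    from that have "length c = length d" "hamming_weight c = hamming_weight d" "c \<noteq> []"
      by (auto simp: arcs_weight_digraph)
    with that(3) show ?thesis
      by (intro cyclic_gap_cong same_weight_same_butlast_support) auto
  qed
  have "\<forall>b \<in> arcs ?G. butlast b = v \<longrightarrow> \<not> cyclic_gap b"
    using assms(1)
  proof (induction rule: reachable_induct)
    case base
    then show ?case using gap_cong assms(2,3) by blast
  next
    case (step x y)
    from step.hyps(2) obtain e where e: "e \<in> arcs ?G" "butlast e = x" "tl e = y"
      by (auto elim: reachableE)
    with step.IH have "\<not> cyclic_gap e" by blast
    moreover have "e \<noteq> []" using e(1) by (auto simp: arcs_weight_digraph)
    \<comment> \<open>All arcs out of \<open>y\<close> share their tail with
      \<open>rotate1 e\<close>, so one gap-free arc settles the others.\<close>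
    ultimately have "\<not> cyclic_gap (rotate1 e)" using cyclic_gap_rotate1 by blast
    moreover have "rotate1 e \<in> arcs ?G" "butlast (rotate1 e) = y"
      using e by (simp_all add: butlast_rotate1)
    ultimately show ?case using gap_cong by blast
  qed
  then show ?thesis using assms(4,5) by blast
qed

text \<open>The zeros of \<open>?a\<close> form one cyclic block of length at least 2, while
  \<open>?b\<close> has an isolated zero. No walk can lead from the tail of \<open>?a\<close> to
  that of \<open>?b\<close>.\<close>

lemma not_eulerian_single_weight:
  assumes "k \<ge> 2" and "2 \<le> r" and "Suc r \<le> m"
  shows "\<not> eulerian (weight_digraph k r r m)"
proof
  let ?G = "weight_digraph k r r m"
  let ?a = "replicate r 1 @ replicate (Suc m - r) (0::nat)"
  let ?b = "replicate (r - 1) 1 @ [0, 1] @ replicate (m - r) (0::nat)"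
  assume "eulerian ?G"
  have a: "?a \<in> arcs ?G" and b: "?b \<in> arcs ?G"
    using assms by (auto simp: arcs_weight_digraph)
  have "\<not> cyclic_gap ?a"
  proof
    assume "cyclic_gap ?a"
    then obtain i where i: "?a ! (i mod Suc m) \<noteq> 0" "?a ! (Suc i mod Suc m) = 0"
        "?a ! (Suc (Suc i) mod Suc m) \<noteq> 0"
      using assms by (auto simp: cyclic_gap_def)
    have nz: "?a ! l \<noteq> 0 \<longleftrightarrow> l < r" if "l < Suc m" for l
      using that assms by (auto simp: nth_append)
    have "i mod Suc m < r" "\<not> Suc i mod Suc m < r" "Suc (Suc i) mod Suc m < r"
      using i nz[of "i mod Suc m"] nz[of "Suc i mod Suc m"] nz[of "Suc (Suc i) mod Suc m"] by auto
    \<comment> \<open>The first two conditions put \<open>i\<close> at \<open>r - 1\<close> modulo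
      \<open>Suc m\<close>. Two places on is \<open>r + 1\<close>, which is at most
      \<open>m\<close>, so it does not wrap around and still holds a zero.\<close>
    then show False using assms by (auto simp: mod_Suc split: if_splits)
  qed
  moreover have "cyclic_gap ?b"
    unfolding cyclic_gap_def
    \<comment> \<open>Positions \<open>r - 2\<close>, \<open>r - 1\<close>, \<open>r\<close> of
      \<open>?b\<close> hold 1, 0, 1; the first exists because \<open>2 \<le> r\<close>.\<close>
    using assms by (intro exI[of _ "r - 2"]) (auto simp: nth_append nth_Cons')
  moreover have "butlast ?a \<rightarrow>\<^sup>*\<^bsub>?G\<^esub> butlast ?b"
    using \<open>eulerian ?G\<close> a b
    by (auto simp del: butlast_append simp: eulerian_def strongly_connected_def verts_weight_digraph)
  ultimately show False
    using reachable_preserves_no_cyclic_gap a b by blast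
qed

theorem theorem3p4:
  fixes k n :: nat
  assumes "k \<ge> 2" and "n \<ge> 2"
  shows "(\<forall>r::nat. r \<le> n \<longrightarrow>
            (eulerian (weight_digraph k r r (n - 1)) \<longleftrightarrow> r \<in> {0, 1, n - 1, n})) \<and>
         (\<forall>r::nat. r < n \<longrightarrow> eulerian (weight_digraph k r (r + 1) (n - 1)))"
proof (intro conjI allI impI)
  fix r assume "r \<le> n"
  show "eulerian (weight_digraph k r r (n - 1)) \<longleftrightarrow> r \<in> {0, 1, n - 1, n}"
  proof
    assume eul: "eulerian (weight_digraph k r r (n - 1))"
    show "r \<in> {0, 1, n - 1, n}"
    proof (rule ccontr)
      assume "r \<notin> {0, 1, n - 1, n}"
      then have "2 \<le> r" "Suc r \<le> n - 1" using \<open>r \<le> n\<close> by auto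
      then show False using not_eulerian_single_weight assms(1) eul by blast
    qed
  next
    assume "r \<in> {0, 1, n - 1, n}"
    then show "eulerian (weight_digraph k r r (n - 1))"
      using assms by (intro eulerian_single_weight) auto
  qed
next
  fix r assume "r < n"
  then show "eulerian (weight_digraph k r (r + 1) (n - 1))"
    using assms(1) by (intro eulerian_two_weights) auto
qed

end
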